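(* Assume $\alpha=\gamma$ and $\alpha+\beta>1$, and let $c\in(0,1)$ satisfy \[\left(\frac{\beta}{c}\right)^c\left(\frac{\alpha}{1-c}\right)^{1-c}=\frac12 .\] If $\alpha<1/2$, then a.a.s. no vertex $u$ of $K(n,P)$ has a neighbor $w$ with $H(u,w)<cn$. If $\beta<1/2$, then a.a.s. no vertex $u$ of $K(n,P)$ has a neighbor $w$ with $H(u,w)>cn$.
   Context: Let $0<\alpha,\beta,\gamma<1$ be constants not depending on $n$, and $P=\begin{pmatrix}\alpha&\beta\\ \beta&\gamma\end{pmatrix}$ indexed by $\{0,1\}$ ($P_{1,1}=\alpha$, $P_{0,1}=P_{1,0}=\beta$, $P_{0,0}=\gamma$). The stochastic Kronecker graph $K(n,P)$ has vertex set $\mathbb Z_2^n$; writing $u_k$ for the $k$-th digit of $u$, each pair $\{u,v\}$ is an edge with probability $p_{u,v}=\prod_{k=1}^n P_{u_k,v_k}$, independently of all other pairs. $H(u,w)$ is the Hamming distance between $u$ and $w$. A.a.s. means with probability tending to $1$ as $n\to\infty$. *)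

theory Defs
  imports "HOL-Probability.Probability" "HOL-Library.Z2"
begin

text \<open>Elements of \<open>\<int>\<^sub>2\<^sup>n\<close> are extensional functions on \<open>{1..n}\<close>, so \<open>u k\<close> is the \<open>k\<close>-th digit.\<close>

definition Z2_cube :: "nat \<Rightarrow> (nat \<Rightarrow> bit) set" where
  "Z2_cube n = {1..n} \<rightarrow>\<^sub>E UNIV"

definition hamming :: "nat \<Rightarrow> (nat \<Rightarrow> bit) \<Rightarrow> (nat \<Rightarrow> bit) \<Rightarrow> nat" where
  "hamming n u w = card {k \<in> {1..n}. u k \<noteq> w k}"

definition initiator :: "real \<Rightarrow> real \<Rightarrow> real \<Rightarrow> bit \<Rightarrow> bit \<Rightarrow> real" where
  "initiator \<alpha> \<beta> \<gamma> a b =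
     (if a = 1 \<and> b = 1 then \<alpha> else if a = 0 \<and> b = 0 then \<gamma> else \<beta>)"

definition kron_prob ::
    "nat \<Rightarrow> (bit \<Rightarrow> bit \<Rightarrow> real) \<Rightarrow> (nat \<Rightarrow> bit) \<Rightarrow> (nat \<Rightarrow> bit) \<Rightarrow> real" where
  "kron_prob n P u v = (\<Prod>k=1..n. P (u k) (v k))"

definition vertex_pairs :: "nat \<Rightarrow> (nat \<Rightarrow> bit) set set" where
  "vertex_pairs n = {e. e \<subseteq> Z2_cube n \<and> card e = 2}"

text \<open>The value on an unordered pair is well defined only for symmetric \<open>P\<close>; see
  \<open>kron_pair_prob_insert\<close> below.\<close>

definition kron_pair_prob ::
    "nat \<Rightarrow> (bit \<Rightarrow> bit \<Rightarrow> real) \<Rightarrow> (nat \<Rightarrow> bit) set \<Rightarrow> real" where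
  "kron_pair_prob n P e = (THE p. \<forall>u v. e = {u, v} \<longrightarrow> p = kron_prob n P u v)"

text \<open>\<open>K(n,P)\<close>, as the distribution of its edge set on the vertex set \<open>Z2_cube n\<close>: an independent
  Bernoulli variable for each pair of distinct vertices.\<close>

definition kronecker_graph ::
    "nat \<Rightarrow> (bit \<Rightarrow> bit \<Rightarrow> real) \<Rightarrow> (nat \<Rightarrow> bit) set set pmf" where
  "kronecker_graph n P =
     map_pmf (\<lambda>X. {e \<in> vertex_pairs n. X e})
       (Pi_pmf (vertex_pairs n) False (\<lambda>e. bernoulli_pmf (kron_pair_prob n P e)))"

definition aas :: "(nat \<Rightarrow> 'a pmf) \<Rightarrow> (nat \<Rightarrow> 'a \<Rightarrow> bool) \<Rightarrow> bool" where
  "aas G Q \<longleftrightarrow> (\<lambda>n. measure_pmf.prob (G n) {x. Q n x}) \<longlonglongrightarrow> 1"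

lemma initiator_sym: "initiator \<alpha> \<beta> \<gamma> a b = initiator \<alpha> \<beta> \<gamma> b a"
  by (auto simp: initiator_def)

lemma kron_pair_prob_insert:
  assumes "\<And>a b. P a b = P b a"
  shows "kron_pair_prob n P {u, v} = kron_prob n P u v"
proof -
  have sym: "kron_prob n P u v = kron_prob n P v u"
    unfolding kron_prob_def by (intro prod.cong refl assms)
  show ?thesis
    unfolding kron_pair_prob_def
    by (rule the_equality) (auto simp: doubleton_eq_iff sym)
qed

lemma kron_prob_bounds:
  assumes "0 < \<alpha>" "\<alpha> < 1" "0 < \<beta>" "\<beta> < 1" "0 < \<gamma>" "\<gamma> < 1"
  shows "0 \<le> kron_prob n (initiator \<alpha> \<beta> \<gamma>) u v" "kron_prob n (initiator \<alpha> \<beta> \<gamma>) u v \<le> 1"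
  using assms unfolding kron_prob_def initiator_def
  by (auto intro!: prod_nonneg prod_le_1)

lemma finite_vertex_pairs: "finite (vertex_pairs n)"
proof -
  have "(UNIV :: bit set) = {0, 1}"
    by (auto intro: bit_not_zero_iff[THEN iffD1])
  then have "finite (UNIV :: bit set)"
    by (metis finite.emptyI finite_insert)
  then have "finite (Z2_cube n)"
    unfolding Z2_cube_def by (intro finite_PiE) auto
  then show ?thesis
    unfolding vertex_pairs_def by (rule finite_subset[rotated, OF finite_Pow_iff[THEN iffD2]]) auto
qed

lemma kronecker_graph_edge_prob:
  assumes "0 < \<alpha>" "\<alpha> < 1" "0 < \<beta>" "\<beta> < 1" "0 < \<gamma>" "\<gamma> < 1"
    and "u \<in> Z2_cube n" "v \<in> Z2_cube n" "u \<noteq> v"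
  shows "measure_pmf.prob (kronecker_graph n (initiator \<alpha> \<beta> \<gamma>)) {E. {u, v} \<in> E}
           = kron_prob n (initiator \<alpha> \<beta> \<gamma>) u v"
proof -
  let ?P = "initiator \<alpha> \<beta> \<gamma>"
  let ?D = "Pi_pmf (vertex_pairs n) False (\<lambda>e. bernoulli_pmf (kron_pair_prob n ?P e))"
  have mem: "{u, v} \<in> vertex_pairs n"
    using assms(7-9) by (auto simp: vertex_pairs_def)
  have "measure_pmf.prob (kronecker_graph n ?P) {E. {u, v} \<in> E}
          = measure_pmf.prob (map_pmf (\<lambda>X. X {u, v}) ?D) {True}"
    using mem by (simp add: kronecker_graph_def vimage_def)
  also have "map_pmf (\<lambda>X. X {u, v}) ?D = bernoulli_pmf (kron_pair_prob n ?P {u, v})"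
    using mem finite_vertex_pairs by (subst Pi_pmf_component) auto
  also have "kron_pair_prob n ?P {u, v} = kron_prob n ?P u v"
    by (rule kron_pair_prob_insert) (rule initiator_sym)
  finally show ?thesis
    using kron_prob_bounds[OF assms(1-6)] by (simp add: measure_pmf_single)
qed

end

theory Submission
  imports Defs "HOL-Real_Asymp.Real_Asymp"
begin

text \<open>By the union bound, the probability of an edge between vertices at distance less than \<open>c n\<close> is
  at most \<open>2\<^sup>n\<close> times the sum of \<open>(n choose d) \<beta>\<^sup>d \<alpha>\<^bsup>n-d\<^esup>\<close> over \<open>d < c n\<close>. At the threshold \<open>c\<close> the
  exponential rate vanishes: the bound is the sum over \<open>d < c n\<close> of the binomial\<open>(n, c)\<close> mass at \<open>d\<close>
  times \<open>L\<close> to the power \<open>d - c n\<close>, where \<open>L > 1\<close> because \<open>\<beta> > 1/2\<close>. The geometric factors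
  sum to a constant, so it suffices that all binomial masses are \<open>O(1/\<surd>n)\<close>. The case of large
  distances follows by exchanging \<open>\<alpha>\<close> with \<open>\<beta>\<close>, \<open>c\<close> with \<open>1 - c\<close> and \<open>d\<close> with \<open>n - d\<close>.\<close>

section \<open>Point masses of the binomial distribution\<close>

lemma Bernstein_Suc_Suc:
  "(real n + 1) * x * Bernstein n k x = (real k + 1) * Bernstein (Suc n) (Suc k) x"
proof -
  have "(real k + 1) * real (Suc n choose Suc k) = (real n + 1) * real (n choose k)"
    using arg_cong[OF Suc_times_binomial[of k n], of real] by (simp add: algebra_simps)
  then show ?thesis
    unfolding Bernstein_def by (simp del: binomial_Suc_Suc add: mult_ac)
qed

lemma Bernstein_Suc_left:
  assumes "k \<le> Suc n"
  shows "(real n + 1) * (1 - x) * Bernstein n k x = (real n + 1 - real k) * Bernstein (Suc n) k x"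
proof (cases "k = Suc n")
  case False
  then have k: "k \<le> n" using assms by simp
  have "(real n + 1 - real k) * real (Suc n choose k) = (real n + 1) * real (n choose k)"
    using arg_cong[OF binomial_absorb_comp[of "Suc n" k], of real] k
    by (simp only: of_nat_mult) (simp add: of_nat_diff Suc_diff_le add_ac add_diff_eq)
  then show ?thesis
    using k unfolding Bernstein_def by (simp add: Suc_diff_le mult_ac)
qed (simp add: Bernstein_def)

text \<open>By the two absorption rules above, the masses at \<open>j\<close> and
  \<open>Suc j\<close> for \<open>n\<close> are multiples of the same mass
  \<open>Bernstein (Suc n) (Suc j) x\<close>, so only the coefficients have to be
  subtracted.\<close>

lemma Bernstein_diff:
  assumes "j \<le> n"
  shows "(real n + 1) * x * (1 - x) * (Bernstein n (Suc j) x - Bernstein n j x)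
       = ((real n + 1) * x - real (Suc j)) * Bernstein (Suc n) (Suc j) x"
  using Bernstein_Suc_Suc[of n x j] Bernstein_Suc_left[of "Suc j" n x] assms
  by (simp add: algebra_simps) algebra

lemma sum_Bernstein_variance:
  "(\<Sum>k\<le>n. (real n * x - real k)\<^sup>2 * Bernstein n k x) = real n * x * (1 - x)"
proof -
  \<comment> \<open>The square is expanded in \<open>1\<close>, \<open>k\<close> and
    \<open>k * (k - 1)\<close>, whose Bernstein sums have known closed forms.\<close>
  have "(\<Sum>k\<le>n. (real n * x - real k)\<^sup>2 * Bernstein n k x)
      = (\<Sum>k\<le>n. real k * (real k - 1) * Bernstein n k x
           + (1 - 2 * real n * x) * (real k * Bernstein n k x) + (real n * x)\<^sup>2 * Bernstein n k x)"
    by (intro sum.cong) (auto simp: power2_eq_square algebra_simps)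
  also have "\<dots> = real n * x * (1 - x)"
    by (simp add: sum.distrib sum_distrib_left[symmetric] del: mult.assoc)
       (simp add: power2_eq_square algebra_simps)
  finally show ?thesis .
qed

text \<open>The mean absolute deviation is at most the standard deviation \<open>s\<close>: sum the
  inequality \<open>2 * s * t \<le> t^2 + s^2\<close> against the masses, where both squares
  contribute the variance \<open>s^2\<close>.\<close>

lemma sum_Bernstein_abs_deviation:
  assumes "0 < x" "x < 1" "0 < n"
  shows "(\<Sum>k\<le>n. \<bar>real n * x - real k\<bar> * Bernstein n k x) \<le> sqrt (real n * x * (1 - x))"
proof -
  define s where "s = sqrt (real n * x * (1 - x))"
  have s: "0 < s" "s\<^sup>2 = real n * x * (1 - x)"
    using assms by (auto simp: s_def)
  have "2 * s * (\<Sum>k\<le>n. \<bar>real n * x - real k\<bar> * Bernstein n k x)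
      = (\<Sum>k\<le>n. (2 * s * \<bar>real n * x - real k\<bar>) * Bernstein n k x)"
    by (simp add: sum_distrib_left mult_ac)
  also have "\<dots> \<le> (\<Sum>k\<le>n. ((real n * x - real k)\<^sup>2 + s\<^sup>2) * Bernstein n k x)"
  proof (intro sum_mono mult_right_mono)
    fix k
    show "2 * s * \<bar>real n * x - real k\<bar> \<le> (real n * x - real k)\<^sup>2 + s\<^sup>2"
      using sum_squares_bound[of s "\<bar>real n * x - real k\<bar>"] by simp
  qed (use assms in \<open>auto intro: Bernstein_nonneg\<close>)
  also have "\<dots> = 2 * s * s"
    by (simp add: distrib_right sum.distrib sum_distrib_left[symmetric] sum_Bernstein_variance
        s(2)[symmetric]) (simp add: power2_eq_square)
  finally show ?thesis
    unfolding s_def[symmetric] using s(1) by simp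
qed

text \<open>A point mass is minus the sum of all later increments, and the increments of the binomial
  distribution with parameter \<open>n\<close> are centred multiples of its masses for \<open>n + 1\<close>.\<close>

lemma Bernstein_le_inverse_sqrt:
  assumes "0 < x" "x < 1"
  shows "Bernstein n d x \<le> 1 / sqrt ((real n + 1) * x * (1 - x))"
proof (cases "d \<le> n")
  case True
  \<comment> \<open>\<open>V\<close> is the factor in \<open>Bernstein_diff\<close> and also the
    variance for parameter \<open>n + 1\<close>. Hence the mean absolute deviation bounds
    \<open>V\<close> times the mass by \<open>sqrt V\<close>.\<close>
  define V where "V = (real n + 1) * x * (1 - x)"
  have V: "0 < V" using assms by (simp add: V_def)
  \<comment> \<open>The mass at \<open>n + 1\<close> is zero, which lets the telescoping sum end
    there.\<close>
  have "V * Bernstein n d x = V * (Bernstein n d x - Bernstein n (Suc n) x)"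
    by (simp add: Bernstein_def)
  also have "\<dots> = V * (\<Sum>j=d..<Suc n. Bernstein n j x - Bernstein n (Suc j) x)"
    using sum_Suc_diff'[of d "Suc n" "\<lambda>j. - Bernstein n j x"] True by (simp add: add.commute)
  also have "\<dots> = (\<Sum>j=d..<Suc n. V * (Bernstein n j x - Bernstein n (Suc j) x))"
    by (rule sum_distrib_left)
  also have "\<dots> \<le> (\<Sum>j=d..<Suc n. \<bar>real (Suc n) * x - real (Suc j)\<bar> * Bernstein (Suc n) (Suc j) x)"
  proof (rule sum_mono)
    fix j assume "j \<in> {d..<Suc n}"
    then have "V * (Bernstein n j x - Bernstein n (Suc j) x)
        = - (real (Suc n) * x - real (Suc j)) * Bernstein (Suc n) (Suc j) x"
      using Bernstein_diff[of j n x] by (simp add: V_def algebra_simps)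
    also have "\<dots> \<le> \<bar>real (Suc n) * x - real (Suc j)\<bar> * Bernstein (Suc n) (Suc j) x"
      using assms by (intro mult_right_mono Bernstein_nonneg) auto
    finally show "V * (Bernstein n j x - Bernstein n (Suc j) x)
        \<le> \<bar>real (Suc n) * x - real (Suc j)\<bar> * Bernstein (Suc n) (Suc j) x" .
  qed
  also have "\<dots> = (\<Sum>k\<in>Suc ` {d..<Suc n}. \<bar>real (Suc n) * x - real k\<bar> * Bernstein (Suc n) k x)"
    by (simp add: sum.reindex del: image_Suc_atLeastLessThan)
  also have "\<dots> \<le> (\<Sum>k\<le>Suc n. \<bar>real (Suc n) * x - real k\<bar> * Bernstein (Suc n) k x)"
    using assms by (intro sum_mono2) (auto intro!: mult_nonneg_nonneg Bernstein_nonneg)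
  also have "\<dots> \<le> sqrt V"
    using sum_Bernstein_abs_deviation[of x "Suc n"] assms by (simp add: V_def add.commute)
  finally have "V * Bernstein n d x \<le> sqrt V" .
  then have "Bernstein n d x \<le> sqrt V / V"
    using V by (simp add: pos_le_divide_eq mult.commute)
  also have "sqrt V / V = 1 / sqrt V"
    using V by (simp add: real_div_sqrt field_simps)
  finally show ?thesis by (simp add: V_def)
qed (use assms in \<open>simp add: Bernstein_def binomial_eq_0\<close>)

section \<open>The binomial tail at the threshold\<close>

text \<open>The equation says that a weighted geometric mean of \<open>b / c\<close> and
  \<open>a / (1 - c)\<close> is 1/2. If \<open>b / c\<close> were the smaller of the two, it would
  be at most 1/2, whereas \<open>b / c > b \<ge> 1/2\<close>.\<close>

lemma tilt_gt_one:
  fixes a b c :: real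
  assumes "0 < a" "0 < b" "0 < c" "c < 1" "1 / 2 \<le> b"
    and "(b / c) powr c * (a / (1 - c)) powr (1 - c) = 1 / 2"
  shows "a / (1 - c) < b / c"
proof (rule ccontr)
  assume "\<not> ?thesis"
  then have "(b / c) powr (1 - c) \<le> (a / (1 - c)) powr (1 - c)"
    using assms by (intro powr_mono2) auto
  then have "(b / c) powr c * (b / c) powr (1 - c) \<le> 1 / 2"
    unfolding assms(6)[symmetric] by (intro mult_left_mono) auto
  then have "b / c \<le> 1 / 2"
    using assms by (simp flip: powr_add)
  then show False
    using assms by (simp add: field_simps)
qed

text \<open>The equation for \<open>c\<close> turns each term of the sum into
  \<open>Bernstein n d c * L powr (d - c * n)\<close>.\<close>

lemma binomial_tail_le:
  fixes a b c :: real
  assumes "0 < a" "0 < b" "0 < c" "c < 1" "1 / 2 \<le> b"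
    and eq: "(b / c) powr c * (a / (1 - c)) powr (1 - c) = 1 / 2"
  defines "L \<equiv> (b / c) / (a / (1 - c))"
  shows "2 ^ n * (\<Sum>d | d \<le> n \<and> real d < c * real n. real (n choose d) * b ^ d * a ^ (n - d))
           \<le> L / (L - 1) / sqrt ((real n + 1) * c * (1 - c))"
proof -
  \<comment> \<open>Chosen so that \<open>2 * a = (1 - c) * y\<close> and
    \<open>2 * b = c * L * y\<close>: the factors \<open>c\<close> and \<open>1 - c\<close> form the
    binomial mass, leaving \<open>L ^ d * y ^ n\<close>.\<close>
  define y where "y = 2 * a / (1 - c)"
  define M where "M = 1 / sqrt ((real n + 1) * c * (1 - c))"
  define K where "K = nat \<lceil>c * real n\<rceil>"
  have y: "0 < y" and L: "1 < L" and M: "0 \<le> M"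
    using assms(1-4) tilt_gt_one[OF assms(1-6)]
    by (simp_all add: y_def M_def L_def less_divide_eq_1_pos
        del: divide_divide_eq_left divide_divide_eq_right)
  have b: "2 * b = c * L * y" and a: "2 * a = (1 - c) * y"
    using assms by (simp_all add: L_def y_def field_simps)
  \<comment> \<open>This is the equation for \<open>c\<close> in terms of \<open>L\<close> and
    \<open>y\<close>; it makes \<open>y ^ n\<close> cancel \<open>L powr (c * n)\<close>.\<close>
  have Ly: "L powr c * y = 1"
  proof -
    have "1 / 2 = (L * (y / 2)) powr c * (y / 2) powr (1 - c)"
    proof -
      have "b / c = L * (y / 2)" "a / (1 - c) = y / 2"
        using assms(1-4) by (simp_all add: L_def y_def field_simps)
      then show ?thesis using eq by metis
    qed
    also have "\<dots> = L powr c * ((y / 2) powr c * (y / 2) powr (1 - c))"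
      using L y by (subst powr_mult) auto
    also have "\<dots> = L powr c * (y / 2)"
      using y by (simp flip: powr_add)
    finally show ?thesis by simp
  qed
  have yL: "y ^ n = L powr (- (c * real n))"
  proof -
    have "y = L powr (- c)"
      using L Ly by (simp add: powr_minus field_simps)
    then show ?thesis
      using L by (simp add: powr_realpow[symmetric] powr_powr)
  qed
  have term_eq: "2 ^ n * (real (n choose d) * b ^ d * a ^ (n - d)) = Bernstein n d c * L ^ d * y ^ n"
    if "d \<le> n" for d
  proof -
    have "2 ^ n * (real (n choose d) * b ^ d * a ^ (n - d))
        = real (n choose d) * (2 * b) ^ d * (2 * a) ^ (n - d)"
      using that by (simp add: power_mult_distrib power_add[symmetric])
    also have "\<dots> = Bernstein n d c * L ^ d * (y ^ d * y ^ (n - d))"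
      unfolding a b by (simp add: Bernstein_def power_mult_distrib)
    finally show ?thesis
      using that by (simp add: power_add[symmetric])
  qed
  have "2 ^ n * (\<Sum>d | d \<le> n \<and> real d < c * real n. real (n choose d) * b ^ d * a ^ (n - d))
      = (\<Sum>d | d \<le> n \<and> real d < c * real n. Bernstein n d c * L ^ d * y ^ n)"
    by (simp add: sum_distrib_left term_eq)
  also have "\<dots> \<le> (\<Sum>d | d \<le> n \<and> real d < c * real n. M * L ^ d * y ^ n)"
    using L y assms unfolding M_def
    by (intro sum_mono mult_right_mono Bernstein_le_inverse_sqrt) auto
  also have "\<dots> \<le> (\<Sum>d<K. M * L ^ d * y ^ n)"
    using L y M by (intro sum_mono2) (auto simp: K_def zless_nat_eq_int_zless less_ceiling_iff)
  also have "\<dots> = M * y ^ n * (\<Sum>d<K. L ^ d)"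
    by (simp add: sum_distrib_left mult_ac)
  also have "\<dots> = M * y ^ n * ((L ^ K - 1) / (L - 1))"
    using L by (simp add: geometric_sum)
  \<comment> \<open>Rounding \<open>c * n\<close> up to \<open>K\<close> costs at most one extra
    factor \<open>L\<close>.\<close>
  also have "\<dots> \<le> M * y ^ n * (L powr (c * real n + 1) / (L - 1))"
  proof -
    have "real K \<le> c * real n + 1"
      using assms by (simp add: K_def of_nat_nat)
    then have "L ^ K \<le> L powr (c * real n + 1)"
      using L by (simp add: powr_realpow[symmetric] powr_mono)
    then show ?thesis
      using L M y by (intro mult_left_mono divide_right_mono) auto
  qed
  also have "\<dots> = M * (L / (L - 1))"
    using L by (simp add: yL powr_add powr_minus)
  finally show ?thesis
    by (simp add: M_def mult.commute)
qed

text \<open>Since \<open>L\<close> does not depend on \<open>n\<close>, the decay of the bound comes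
  from the factor \<open>1 / sqrt (n + 1)\<close> alone.\<close>

lemma binomial_tail_tendsto_zero:
  fixes a b c :: real
  assumes "0 < a" "0 < b" "0 < c" "c < 1" "1 / 2 \<le> b"
    and "(b / c) powr c * (a / (1 - c)) powr (1 - c) = 1 / 2"
  shows "(\<lambda>n. 2 ^ n * (\<Sum>d | d \<le> n \<and> real d < c * real n. real (n choose d) * b ^ d * a ^ (n - d)))
           \<longlonglongrightarrow> 0"
proof (rule tendsto_sandwich[OF always_eventually always_eventually tendsto_const])
  define L where "L = (b / c) / (a / (1 - c))"
  define q where "q = c * (1 - c)"
  have q: "0 < q" using assms by (simp add: q_def)
  show "\<forall>n. 2 ^ n * (\<Sum>d | d \<le> n \<and> real d < c * real n. real (n choose d) * b ^ d * a ^ (n - d))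
           \<le> L / (L - 1) / sqrt ((real n + 1) * q)"
    using binomial_tail_le[OF assms] by (simp add: L_def q_def mult.assoc)
  have "filterlim (\<lambda>n. sqrt ((real n + 1) * q)) at_top sequentially"
    using q by real_asymp
  then show "(\<lambda>n. L / (L - 1) / sqrt ((real n + 1) * q)) \<longlonglongrightarrow> 0"
    by (intro tendsto_divide_0[OF tendsto_const] filterlim_at_top_imp_at_infinity)
qed (use assms in \<open>auto intro!: mult_nonneg_nonneg sum_nonneg\<close>)

section \<open>Hamming distances and edge probabilities\<close>

lemma bit_eqI_zero: "(x = 0 \<longleftrightarrow> y = 0) \<Longrightarrow> x = (y :: bit)"
  by (metis bit_not_zero_iff)

lemma UNIV_bit: "(UNIV :: bit set) = {0, 1}"
  using bit_not_zero_iff by blast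

lemma finite_Z2_cube: "finite (Z2_cube n)"
  unfolding Z2_cube_def UNIV_bit by (intro finite_PiE) auto

lemma card_Z2_cube: "card (Z2_cube n) = 2 ^ n"
  unfolding Z2_cube_def UNIV_bit by (simp add: card_PiE numeral_2_eq_2)

text \<open>Digits are two-valued, so two digits that both differ from \<open>u k\<close> coincide;
  outside \<open>{1..n}\<close> extensionality decides.\<close>

lemma inj_on_difference_set: "inj_on (\<lambda>w. {k \<in> {1..n}. u k \<noteq> w k}) (Z2_cube n)"
proof (rule inj_onI)
  fix v w assume vw: "v \<in> Z2_cube n" "w \<in> Z2_cube n"
    and eq: "{k \<in> {1..n}. u k \<noteq> v k} = {k \<in> {1..n}. u k \<noteq> w k}"
  show "v = w"
  proof (rule PiE_ext)
    fix k assume "k \<in> {1..n}"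
    with eq have "u k \<noteq> v k \<longleftrightarrow> u k \<noteq> w k" by blast
    then show "v k = w k"
      by (metis bit_not_zero_iff)
  qed (use vw in \<open>auto simp: Z2_cube_def\<close>)
qed

lemma hamming_le: "hamming n u w \<le> n"
  unfolding hamming_def by (rule order_trans[OF card_mono[of "{1..n}"]]) auto

lemma card_hamming_sphere_le: "card {w \<in> Z2_cube n. hamming n u w = d} \<le> n choose d"
proof -
  let ?diff = "\<lambda>w. {k \<in> {1..n}. u k \<noteq> w k}"
  have "card {w \<in> Z2_cube n. hamming n u w = d} \<le> card {S. S \<subseteq> {1..n} \<and> card S = d}"
  proof (rule card_inj_on_le)
    show "inj_on ?diff {w \<in> Z2_cube n. hamming n u w = d}"
      by (rule inj_on_subset[OF inj_on_difference_set]) auto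
  qed (auto simp: hamming_def)
  then show ?thesis by (simp add: n_subsets)
qed

text \<open>With equal diagonal entries a digit contributes \<alpha> where \<open>u\<close> and
  \<open>w\<close> agree, whatever the common value, and \<beta> where they differ.\<close>

lemma kron_prob_initiator:
  "kron_prob n (initiator \<alpha> \<beta> \<alpha>) u w = \<beta> ^ hamming n u w * \<alpha> ^ (n - hamming n u w)"
proof -
  let ?D = "{k \<in> {1..n}. u k \<noteq> w k}"
  have "kron_prob n (initiator \<alpha> \<beta> \<alpha>) u w = (\<Prod>k=1..n. if u k \<noteq> w k then \<beta> else \<alpha>)"
    unfolding kron_prob_def initiator_def by (intro prod.cong) (auto intro: bit_eqI_zero)
  also have "\<dots> = \<beta> ^ card ?D * \<alpha> ^ card ({1..n} - ?D)"
  proof -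
    have "{1..n} \<inter> {k. u k \<noteq> w k} = ?D" "{1..n} \<inter> - {k. u k \<noteq> w k} = {1..n} - ?D"
      by auto
    then show ?thesis by (simp add: prod.If_cases)
  qed
  also have "card ({1..n} - ?D) = n - card ?D"
    by (subst card_Diff_subset) auto
  finally show ?thesis by (simp add: hamming_def)
qed

text \<open>An inequality, so that \<open>u = w\<close> is covered too: a singleton is never an edge
  and has probability 0. The union bound can then run over all pairs.\<close>

lemma edge_prob_le:
  assumes "0 < \<alpha>" "\<alpha> < 1" "0 < \<beta>" "\<beta> < 1" "u \<in> Z2_cube n" "w \<in> Z2_cube n"
  shows "measure_pmf.prob (kronecker_graph n (initiator \<alpha> \<beta> \<alpha>)) {E. {u, w} \<in> E}
           \<le> \<beta> ^ hamming n u w * \<alpha> ^ (n - hamming n u w)"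
proof (cases "u = w")
  case True
  have "measure_pmf.prob (kronecker_graph n (initiator \<alpha> \<beta> \<alpha>)) {E. {u, w} \<in> E} = 0"
    using True by (simp add: kronecker_graph_def vertex_pairs_def vimage_def)
  then show ?thesis using assms by simp
next
  case False
  then show ?thesis
    using kronecker_graph_edge_prob[of \<alpha> \<beta> \<alpha> u n w] assms by (simp add: kron_prob_initiator)
qed

section \<open>Union bound and conclusion\<close>

text \<open>A union bound over ordered pairs: each of the \<open>2 ^ n\<close> choices of
  \<open>u\<close> contributes at most the same sum over distances. The predicate \<open>Q\<close>
  is left open to serve both short and long edges.\<close>

lemma prob_edge_at_distance_le:
  assumes "0 < \<alpha>" "\<alpha> < 1" "0 < \<beta>" "\<beta> < 1"
  shows "measure_pmf.prob (kronecker_graph n (initiator \<alpha> \<beta> \<alpha>))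
           {E. \<exists>u\<in>Z2_cube n. \<exists>w\<in>Z2_cube n. {u, w} \<in> E \<and> Q (hamming n u w)}
       \<le> 2 ^ n * (\<Sum>d | d \<le> n \<and> Q d. real (n choose d) * \<beta> ^ d * \<alpha> ^ (n - d))"
proof -
  let ?G = "kronecker_graph n (initiator \<alpha> \<beta> \<alpha>)"
  let ?f = "\<lambda>d. \<beta> ^ d * \<alpha> ^ (n - d)"
  let ?B = "\<lambda>u. {w \<in> Z2_cube n. Q (hamming n u w)}"
  let ?D = "{d. d \<le> n \<and> Q d}"
  have fin: "finite (?B u)" for u
    using finite_Z2_cube by simp
  have row: "(\<Sum>w\<in>?B u. ?f (hamming n u w)) \<le> (\<Sum>d\<in>?D. real (n choose d) * ?f d)" for u
  proof -
    \<comment> \<open>The summand depends on \<open>w\<close> only through its distance from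
      \<open>u\<close>, so the sum is grouped into Hamming spheres.\<close>
    have "(\<Sum>w\<in>?B u. ?f (hamming n u w))
        = (\<Sum>d\<in>?D. \<Sum>w | w \<in> ?B u \<and> hamming n u w = d. ?f (hamming n u w))"
      by (rule sum.group[symmetric]) (use fin in \<open>auto intro: hamming_le\<close>)
    also have "\<dots> = (\<Sum>d\<in>?D. real (card {w \<in> Z2_cube n. hamming n u w = d}) * ?f d)"
    proof (rule sum.cong[OF refl])
      fix d assume "d \<in> ?D"
      then have "{w. w \<in> ?B u \<and> hamming n u w = d} = {w \<in> Z2_cube n. hamming n u w = d}"
        by auto
      then show "(\<Sum>w | w \<in> ?B u \<and> hamming n u w = d. ?f (hamming n u w))
          = real (card {w \<in> Z2_cube n. hamming n u w = d}) * ?f d"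
        by simp
    qed
    also have "\<dots> \<le> (\<Sum>d\<in>?D. real (n choose d) * ?f d)"
      using assms by (intro sum_mono mult_right_mono) (auto simp: card_hamming_sphere_le)
    finally show ?thesis .
  qed
  have "{E. \<exists>u\<in>Z2_cube n. \<exists>w\<in>Z2_cube n. {u, w} \<in> E \<and> Q (hamming n u w)}
      = (\<Union>(u, w)\<in>(SIGMA u:Z2_cube n. ?B u). {E. {u, w} \<in> E})"
    by auto
  then have "measure_pmf.prob ?G
        {E. \<exists>u\<in>Z2_cube n. \<exists>w\<in>Z2_cube n. {u, w} \<in> E \<and> Q (hamming n u w)}
      \<le> (\<Sum>(u, w)\<in>(SIGMA u:Z2_cube n. ?B u). measure_pmf.prob ?G {E. {u, w} \<in> E})"
    using measure_pmf.finite_measure_subadditive_finite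
        [of "SIGMA u:Z2_cube n. ?B u" "\<lambda>(u, w). {E. {u, w} \<in> E}" ?G]
      finite_SigmaI[OF finite_Z2_cube fin]
    by (simp add: case_prod_unfold)
  also have "\<dots> \<le> (\<Sum>(u, w)\<in>(SIGMA u:Z2_cube n. ?B u). ?f (hamming n u w))"
    using assms by (intro sum_mono) (auto intro: edge_prob_le)
  also have "\<dots> = (\<Sum>u\<in>Z2_cube n. \<Sum>w\<in>?B u. ?f (hamming n u w))"
    by (rule sum.Sigma[symmetric]) (use finite_Z2_cube fin in auto)
  also have "\<dots> \<le> (\<Sum>u\<in>Z2_cube n. \<Sum>d\<in>?D. real (n choose d) * ?f d)"
    by (intro sum_mono row)
  finally show ?thesis
    by (simp add: card_Z2_cube mult.assoc)
qed

lemma aas_not_if_tendsto_zero: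
  assumes "\<And>n. measure_pmf.prob (G n) {x. R n x} \<le> f n" and "f \<longlonglongrightarrow> 0"
  shows "aas G (\<lambda>n x. \<not> R n x)"
proof -
  have "(\<lambda>n. measure_pmf.prob (G n) {x. R n x}) \<longlonglongrightarrow> 0"
    by (rule tendsto_sandwich[OF _ _ tendsto_const assms(2)]) (auto simp: assms(1))
  then have "(\<lambda>n. 1 - measure_pmf.prob (G n) {x. R n x}) \<longlonglongrightarrow> 1 - 0"
    by (intro tendsto_intros)
  moreover have "measure_pmf.prob (G n) {x. \<not> R n x} = 1 - measure_pmf.prob (G n) {x. R n x}" for n
    using measure_pmf.prob_compl[of "{x. R n x}" "G n"]
    by (simp add: Compl_eq_Diff_UNIV[symmetric] Collect_neg_eq)
  ultimately show ?thesis
    by (simp add: aas_def)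
qed

text \<open>The substitution of \<open>n - d\<close> for \<open>d\<close> turns an upper tail into a
  lower one, so that one tail estimate serves both claims.\<close>

lemma binomial_sum_reflect:
  fixes a b :: real
  shows "(\<Sum>d | d \<le> n \<and> Q d. real (n choose d) * b ^ d * a ^ (n - d))
       = (\<Sum>d | d \<le> n \<and> Q (n - d). real (n choose d) * a ^ d * b ^ (n - d))"
  by (rule sum.reindex_bij_witness[of _ "\<lambda>d. n - d" "\<lambda>d. n - d"])
     (auto simp: binomial_symmetric[symmetric] mult_ac)

theorem theorem18:
  fixes \<alpha> \<beta> \<gamma> c :: real
  assumes "0 < \<alpha>" "\<alpha> < 1" "0 < \<beta>" "\<beta> < 1" "0 < \<gamma>" "\<gamma> < 1"
    and "\<alpha> = \<gamma>" and "\<alpha> + \<beta> > 1"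
    and "0 < c" "c < 1"
    and "(\<beta> / c) powr c * (\<alpha> / (1 - c)) powr (1 - c) = 1 / 2"
  shows "(\<alpha> < 1 / 2 \<longrightarrow>
            aas (\<lambda>n. kronecker_graph n (initiator \<alpha> \<beta> \<gamma>))
              (\<lambda>n E. \<not> (\<exists>u \<in> Z2_cube n. \<exists>w \<in> Z2_cube n.
                 {u, w} \<in> E \<and> real (hamming n u w) < c * real n))) \<and>
         (\<beta> < 1 / 2 \<longrightarrow>
            aas (\<lambda>n. kronecker_graph n (initiator \<alpha> \<beta> \<gamma>))
              (\<lambda>n E. \<not> (\<exists>u \<in> Z2_cube n. \<exists>w \<in> Z2_cube n.
                 {u, w} \<in> E \<and> real (hamming n u w) > c * real n)))"
proof (intro conjI impI)
  note bound = prob_edge_at_distance_le[OF assms(1-4), unfolded \<open>\<alpha> = \<gamma>\<close>]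
  show "aas (\<lambda>n. kronecker_graph n (initiator \<alpha> \<beta> \<gamma>))
      (\<lambda>n E. \<not> (\<exists>u \<in> Z2_cube n. \<exists>w \<in> Z2_cube n.
         {u, w} \<in> E \<and> real (hamming n u w) < c * real n))" if "\<alpha> < 1 / 2"
    \<comment> \<open>Here \<alpha> < 1/2 and \<alpha> + \<beta> > 1 give \<beta> > 1/2, as the tail
      estimate requires of \<open>b\<close>.\<close>
    unfolding \<open>\<alpha> = \<gamma>\<close>
    by (rule aas_not_if_tendsto_zero[OF bound])
       (use assms that in \<open>intro binomial_tail_tendsto_zero; simp\<close>)
  show "aas (\<lambda>n. kronecker_graph n (initiator \<alpha> \<beta> \<gamma>))
      (\<lambda>n E. \<not> (\<exists>u \<in> Z2_cube n. \<exists>w \<in> Z2_cube n.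
         {u, w} \<in> E \<and> real (hamming n u w) > c * real n))" if "\<beta> < 1 / 2"
    unfolding \<open>\<alpha> = \<gamma>\<close>
  proof (rule aas_not_if_tendsto_zero[OF bound])
    have "{d. d \<le> n \<and> c * real n < real (n - d)} = {d. d \<le> n \<and> real d < (1 - c) * real n}" for n
      by (auto simp: of_nat_diff algebra_simps)
    \<comment> \<open>Now \<gamma> = \<alpha> > 1/2 takes the role of \<open>b\<close>, \<beta> that
      of \<open>a\<close>, and \<open>1 - c\<close> that of \<open>c\<close>; this exchange only
      swaps the two factors in the equation for \<open>c\<close>.\<close>
    moreover have "(\<lambda>n. 2 ^ n * (\<Sum>d | d \<le> n \<and> real d < (1 - c) * real n.
        real (n choose d) * \<gamma> ^ d * \<beta> ^ (n - d))) \<longlonglongrightarrow> 0"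
      using assms that by (intro binomial_tail_tendsto_zero) (auto simp: mult.commute)
    ultimately show "(\<lambda>n. 2 ^ n * (\<Sum>d | d \<le> n \<and> c * real n < real d.
        real (n choose d) * \<beta> ^ d * \<gamma> ^ (n - d))) \<longlonglongrightarrow> 0"
      by (subst binomial_sum_reflect) simp
  qed
qed

end
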